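(* For every instance $\mathbb I$ of matroid-PBPI, the commitment gap satisfies $\mathrm{CG}(\mathbb I)\le\sqrt2$.
   Context: Pandora's Box with Partial Inspection (PBPI), minimization. There are $n$ boxes; box $i$ is $\mathcal B_i=(\mathcal D_i,c^o_i,c^p_i)$ with a value $X_i\sim\mathcal D_i$ (nonnegative, independent across boxes, finite support), an opening cost $c^o_i>0$ and a peeking cost $c^p_i\in(0,c^o_i]$. Box $i$ is modeled as a costly information MDP: from the initial (closed) state there are two actions, "open" (cost $c^o_i$, leading to a terminal state of value $X_i$) and "peek" (cost $c^p_i$, revealing $X_i$ and leading to a terminal state of value $X_i+c^o_i$, reflecting that a peeked box must still be opened before being selected). Accepting a terminal state means selecting the box and paying its terminal value. Matroid-PBPI is matroid-min-CICS over these MDPs: given a matroid on $[n]$, $\mathcal F$ is the family of subsets containing a basis; a policy adaptively chooses which box to act on and which action to take, selects boxes only from terminal states, and stops when the selected set lies in $\mathcal F$; its cost is all inspection costs plus terminal values of selected boxes; $\mathrm{OPT}(\mathbb I)$ is the minimum expected cost. A commitment for a box is a (possibly randomized) choice, made in advance, between opening directly and peeking (and then possibly opening); a committing policy is any policy for the instance in which each box is restricted to its committed action. The commitment gap $\mathrm{CG}(\mathbb I)$ is the minimum over tuples of commitments of the optimal expected cost of the restricted instance, divided by $\mathrm{OPT}(\mathbb I)$. *)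

theory Defs
  imports "HOL-Probability.Probability"
begin

definition matroid_on :: "'e set \<Rightarrow> ('e set \<Rightarrow> bool) \<Rightarrow> bool" where
  "matroid_on E indep \<longleftrightarrow>
     finite E \<and>
     (\<forall>S. indep S \<longrightarrow> S \<subseteq> E) \<and>
     indep {} \<and>
     (\<forall>S T. indep T \<and> S \<subseteq> T \<longrightarrow> indep S) \<and>
     (\<forall>S T. indep S \<and> indep T \<and> card S < card T \<longrightarrow> (\<exists>e\<in>T - S. indep (insert e S)))"

definition is_basis :: "('e set \<Rightarrow> bool) \<Rightarrow> 'e set \<Rightarrow> bool" where
  "is_basis indep B \<longleftrightarrow> indep B \<and> (\<forall>S. indep S \<and> B \<subseteq> S \<longrightarrow> S = B)"

definition contains_basis :: "'e set \<Rightarrow> ('e set \<Rightarrow> bool) \<Rightarrow> 'e set set" where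
  "contains_basis E indep = {S. S \<subseteq> E \<and> (\<exists>B. is_basis indep B \<and> B \<subseteq> S)}"

text \<open>The field \<open>tval\<close> is meaningful on terminal states only; \<open>acost\<close> and \<open>trans\<close>
  are meaningful only for actions available in the given state.\<close>

record ('s, 'a) ci_mdp =
  init :: 's
  terminal :: "'s set"
  acts :: "'s \<Rightarrow> 'a set"
  acost :: "'s \<Rightarrow> 'a \<Rightarrow> real"
  trans :: "'s \<Rightarrow> 'a \<Rightarrow> 's pmf"
  tval :: "'s \<Rightarrow> real"

text \<open>Policies are decision trees, so that every decision may depend on the whole history.
  \<open>Act i a k\<close> takes action \<open>a\<close> in the MDP of box \<open>i\<close> and continues with \<open>k s'\<close>, where
  \<open>s'\<close> is the new state of that box.\<close>

datatype ('s, 'a) policy =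
    Stop
  | Act nat 'a "'s \<Rightarrow> ('s, 'a) policy"
  | Select nat "('s, 'a) policy"

text \<open>\<open>feasible M n F p S s\<close>: starting with the selected set \<open>S\<close> and the joint state \<open>s\<close> of the
  boxes \<open>0, \<dots>, n - 1\<close>, the policy \<open>p\<close> uses available actions only, selects from terminal states
  only, and on every outcome of positive probability runs exactly until the selected set is
  in \<open>F\<close>.\<close>

primrec feasible ::
  "(nat \<Rightarrow> ('s, 'a) ci_mdp) \<Rightarrow> nat \<Rightarrow> nat set set \<Rightarrow> ('s, 'a) policy \<Rightarrow>
     nat set \<Rightarrow> (nat \<Rightarrow> 's) \<Rightarrow> bool" where
  "feasible M n F Stop = (\<lambda>S s. S \<in> F)"
| "feasible M n F (Act i a k) = (\<lambda>S s.
     S \<notin> F \<and> i < n \<and> a \<in> acts (M i) (s i) \<and>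
     (\<forall>s'\<in>set_pmf (trans (M i) (s i) a). feasible M n F (k s') S (s(i := s'))))"
| "feasible M n F (Select i p) = (\<lambda>S s.
     S \<notin> F \<and> i < n \<and> i \<notin> S \<and> s i \<in> terminal (M i) \<and> feasible M n F p (insert i S) s)"

text \<open>Every transition is sampled afresh from the kernel of its own box, which makes the boxes
  independent.\<close>

primrec exp_cost ::
  "(nat \<Rightarrow> ('s, 'a) ci_mdp) \<Rightarrow> ('s, 'a) policy \<Rightarrow> (nat \<Rightarrow> 's) \<Rightarrow> real" where
  "exp_cost M Stop = (\<lambda>s. 0)"
| "exp_cost M (Act i a k) = (\<lambda>s.
     acost (M i) (s i) a +
     measure_pmf.expectation (trans (M i) (s i) a) (\<lambda>s'. exp_cost M (k s') (s(i := s'))))"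
| "exp_cost M (Select i p) = (\<lambda>s. tval (M i) (s i) + exp_cost M p s)"

definition opt_cost :: "(nat \<Rightarrow> ('s, 'a) ci_mdp) \<Rightarrow> nat \<Rightarrow> nat set set \<Rightarrow> real" where
  "opt_cost M n F =
     (INF p\<in>{p. feasible M n F p {} (\<lambda>i. init (M i))}. exp_cost M p (\<lambda>i. init (M i)))"

record pbpi_box =
  value_dist :: "real pmf"
  open_cost :: real
  peek_cost :: real

definition valid_box :: "pbpi_box \<Rightarrow> bool" where
  "valid_box b \<longleftrightarrow>
     finite (set_pmf (value_dist b)) \<and> set_pmf (value_dist b) \<subseteq> {0..} \<and>
     0 < open_cost b \<and> 0 < peek_cost b \<and> peek_cost b \<le> open_cost b"

datatype box_state = Closed | Opened real | Peeked real

datatype box_action = Open | Peek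

definition box_mdp :: "pbpi_box \<Rightarrow> (box_state, box_action) ci_mdp" where
  "box_mdp b = \<lparr>
     init = Closed,
     terminal = range Opened \<union> range Peeked,
     acts = (\<lambda>s. if s = Closed then {Open, Peek} else {}),
     acost = (\<lambda>s a. case a of Open \<Rightarrow> open_cost b | Peek \<Rightarrow> peek_cost b),
     trans = (\<lambda>s a. case a of
         Open \<Rightarrow> map_pmf Opened (value_dist b)
       | Peek \<Rightarrow> map_pmf Peeked (value_dist b)),
     tval = (\<lambda>s. case s of
         Closed \<Rightarrow> 0
       | Opened x \<Rightarrow> x
       | Peeked x \<Rightarrow> x + open_cost b) \<rparr>"

definition restrict_mdp :: "('s, 'a) ci_mdp \<Rightarrow> 'a \<Rightarrow> ('s, 'a) ci_mdp" where
  "restrict_mdp m a = m\<lparr>acts := (\<lambda>s. acts m s \<inter> {a})\<rparr>"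

definition pbpi_opt :: "(nat \<Rightarrow> pbpi_box) \<Rightarrow> nat \<Rightarrow> nat set set \<Rightarrow> real" where
  "pbpi_opt B n F = opt_cost (\<lambda>i. box_mdp (B i)) n F"

text \<open>A commitment of a box is a distribution over its two actions. The choices are drawn
  independently in advance, so the policy for the restricted instance knows their outcome.\<close>

definition pbpi_committed_opt ::
  "(nat \<Rightarrow> pbpi_box) \<Rightarrow> nat \<Rightarrow> nat set set \<Rightarrow> (nat \<Rightarrow> box_action pmf) \<Rightarrow> real" where
  "pbpi_committed_opt B n F q =
     measure_pmf.expectation (Pi_pmf {..<n} Open q)
       (\<lambda>c. opt_cost (\<lambda>i. restrict_mdp (box_mdp (B i)) (c i)) n F)"

text \<open>The infimum is a minimum, attained by a deterministic tuple of commitments. If the empty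
  set is feasible, the ratio is 0 / 0 = 0.\<close>

definition commitment_gap :: "(nat \<Rightarrow> pbpi_box) \<Rightarrow> nat \<Rightarrow> nat set set \<Rightarrow> real" where
  "commitment_gap B n F = (INF q. pbpi_committed_opt B n F q) / pbpi_opt B n F"

end

theory Submission
  imports Defs
begin

text \<open>Let \<open>V\<close> be the terminal value and \<open>a\<close> the cost of an action of a box, let \<open>g\<close> be its index,
  defined by \<open>E (g - V)\<^sup>+ = a\<close>, and call \<open>W = max g V\<close> its surrogate weight. Once every box is
  committed to an action, the policy that always continues with the smallest index (closed box) or
  value (inspected box) among the elements not spanned by the selected set mimics the greedy
  algorithm and pays at most the expected weight of a minimum-weight basis for independent weights
  \<open>W\<^sub>i\<close>. Conversely, the expected weight of a cheapest completion of the selected set is a potential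
  which shows that any policy pays at least \<open>1 / \<alpha>\<close> times this quantity, provided that
  \<open>E (min t W\<^sub>i) \<le> \<alpha> a + E (min t (\<alpha> V))\<close> for all \<open>t \<ge> 0\<close> and both actions of box \<open>i\<close>: the
  cost of a cheapest completion depends on a single weight \<open>x\<close> as \<open>b + min t x\<close>.

  Draw the commitment of a box with opening cost \<open>h\<close> and peeking cost \<open>c\<close> at random, peeking with
  probability \<open>q\<close>, so that \<open>W\<^sub>i\<close> is a mixture. The condition then reduces to
  \<open>q c \<le> (\<alpha> - 1) h\<close> and \<open>(1 - q) h + q c \<le> \<alpha> c\<close>. For \<open>\<alpha> = 4 / 3\<close> these are satisfied by
  \<open>q = min 1 (h / (3 c))\<close>, because \<open>(2 c - h)\<^sup>2 \<ge> 0\<close>; and \<open>4 / 3 \<le> sqrt 2\<close>.\<close>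

section \<open>Finitely supported expectations\<close>

lemma expectation_mono_finite:
  fixes f g :: "'a \<Rightarrow> real"
  assumes "finite (set_pmf p)" "\<And>x. x \<in> set_pmf p \<Longrightarrow> f x \<le> g x"
  shows "measure_pmf.expectation p f \<le> measure_pmf.expectation p g"
  using assms by (intro integral_mono_AE integrable_measure_pmf_finite) (auto simp: AE_measure_pmf_iff)

lemma expectation_cong:
  fixes f g :: "'a \<Rightarrow> real"
  assumes "\<And>x. x \<in> set_pmf p \<Longrightarrow> f x = g x"
  shows "measure_pmf.expectation p f = measure_pmf.expectation p g"
  using assms by (intro integral_cong_AE) (auto simp: AE_measure_pmf_iff)

lemma expectation_add_finite:
  fixes f g :: "'a \<Rightarrow> real"
  assumes "finite (set_pmf p)"
  shows "measure_pmf.expectation p (\<lambda>x. f x + g x) =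
    measure_pmf.expectation p f + measure_pmf.expectation p g"
  using assms by (intro Bochner_Integration.integral_add integrable_measure_pmf_finite)

lemma expectation_bind_finite:
  fixes h :: "'b \<Rightarrow> real"
  assumes "finite (set_pmf p)" "\<And>x. x \<in> set_pmf p \<Longrightarrow> finite (set_pmf (f x))"
  shows "measure_pmf.expectation (bind_pmf p f) h =
    measure_pmf.expectation p (\<lambda>x. measure_pmf.expectation (f x) h)"
  using assms
  by (subst pmf_expectation_bind[of "set_pmf p"], simp_all)
     (subst integral_measure_pmf[of "set_pmf p"], simp_all)

lemma expectation_swap_finite:
  fixes f :: "'a \<Rightarrow> 'b \<Rightarrow> real"
  assumes "finite (set_pmf p)" "finite (set_pmf q)"
  shows "measure_pmf.expectation p (\<lambda>x. measure_pmf.expectation q (f x)) =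
    measure_pmf.expectation q (\<lambda>y. measure_pmf.expectation p (\<lambda>x. f x y))"
proof -
  have q: "measure_pmf.expectation q h = (\<Sum>y\<in>set_pmf q. pmf q y * h y)" for h :: "'b \<Rightarrow> real"
    using assms by (subst integral_measure_pmf[of "set_pmf q"]) simp_all
  have p: "measure_pmf.expectation p h = (\<Sum>x\<in>set_pmf p. pmf p x * h x)" for h :: "'a \<Rightarrow> real"
    using assms by (subst integral_measure_pmf[of "set_pmf p"]) simp_all
  show ?thesis
    unfolding p q sum_distrib_left by (subst sum.swap) (simp add: mult.left_commute)
qed

lemma expectation_const_add:
  fixes f :: "'a \<Rightarrow> real"
  assumes "finite (set_pmf p)"
  shows "measure_pmf.expectation p (\<lambda>x. c + f x) = c + measure_pmf.expectation p f"
  using expectation_add_finite[OF assms, of "\<lambda>_. c" f] by simp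

lemma finite_set_Pi_pmf:
  assumes "finite A" "\<And>i. i \<in> A \<Longrightarrow> finite (set_pmf (P i))"
  shows "finite (set_pmf (Pi_pmf A d P))"
  using assms by (subst set_Pi_pmf) auto

text \<open>The law of the remaining coordinates ignores coordinate \<open>i\<close>. Writing the
  product with \<open>P(i := \<mu>)\<close> lets one outer law serve both before an inspection, with
  \<open>\<mu>\<close> the law of a closed box, and after it, with \<open>\<mu>\<close> a point
  mass.\<close>

lemma expectation_Pi_pmf_coordinate:
  fixes f :: "('i \<Rightarrow> 'a) \<Rightarrow> real"
  assumes "finite A" "i \<in> A" "\<And>j. j \<in> A \<Longrightarrow> finite (set_pmf (P j))" "finite (set_pmf \<mu>)"
  shows "measure_pmf.expectation (Pi_pmf A d (P(i := \<mu>))) f =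
    measure_pmf.expectation (Pi_pmf (A - {i}) d P)
      (\<lambda>w. measure_pmf.expectation \<mu> (\<lambda>x. f (w(i := x))))"
proof -
  have "Pi_pmf A d (P(i := \<mu>)) = Pi_pmf (insert i (A - {i})) d (P(i := \<mu>))"
    using assms by (simp add: insert_absorb)
  also have "\<dots> = do {y \<leftarrow> \<mu>; f \<leftarrow> Pi_pmf (A - {i}) d (P(i := \<mu>)); return_pmf (f(i := y))}"
    using assms by (subst Pi_pmf_insert') auto
  also have "Pi_pmf (A - {i}) d (P(i := \<mu>)) = Pi_pmf (A - {i}) d P"
    by (intro Pi_pmf_cong) auto
  finally have *: "Pi_pmf A d (P(i := \<mu>)) =
      do {w \<leftarrow> Pi_pmf (A - {i}) d P; y \<leftarrow> \<mu>; return_pmf (w(i := y))}"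
    by (subst (asm) bind_commute_pmf)
  have fin: "finite (set_pmf (Pi_pmf (A - {i}) d P))"
    using assms by (intro finite_set_Pi_pmf) auto
  show ?thesis
    unfolding * using fin assms by (simp add: expectation_bind_finite)
qed

section \<open>Completing a set to a feasible one\<close>

text \<open>Disjointness from \<open>S\<close> keeps selected elements from being paid for again, so
  their weights do not influence the completion cost.\<close>

definition completions :: "'e set \<Rightarrow> 'e set set \<Rightarrow> 'e set \<Rightarrow> 'e set set" where
  "completions E F S = {T. T \<subseteq> E - S \<and> S \<union> T \<in> F}"

definition completion_cost :: "'e set \<Rightarrow> 'e set set \<Rightarrow> 'e set \<Rightarrow> ('e \<Rightarrow> real) \<Rightarrow> real" where
  "completion_cost E F S w = Min (sum w ` completions E F S)"

text \<open>The property of the family on which the lower bound rests; \<open>E \<in> F\<close>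
  gives every \<open>S \<subseteq> E\<close> a completion.\<close>

definition upward_closed_on :: "'e set \<Rightarrow> 'e set set \<Rightarrow> bool" where
  "upward_closed_on E F \<longleftrightarrow> finite E \<and> E \<in> F \<and> (\<forall>S T. S \<in> F \<and> S \<subseteq> T \<and> T \<subseteq> E \<longrightarrow> T \<in> F)"

lemma finite_completions:
  assumes "upward_closed_on E F"
  shows "finite (completions E F S)"
  using assms by (auto simp: completions_def upward_closed_on_def intro: finite_subset[of _ "Pow E"])

lemma completions_nonempty:
  assumes "upward_closed_on E F" "S \<subseteq> E"
  shows "completions E F S \<noteq> {}"
proof -
  have "S \<union> (E - S) = E" using assms by auto
  then have "E - S \<in> completions E F S"
    using assms by (auto simp: completions_def upward_closed_on_def)
  then show ?thesis by auto
qed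

lemma completion_cost_le:
  assumes "upward_closed_on E F" "T \<in> completions E F S"
  shows "completion_cost E F S w \<le> sum w T"
  using assms by (auto simp: completion_cost_def finite_completions)

lemma completion_cost_witness:
  assumes "upward_closed_on E F" "S \<subseteq> E"
  obtains T where "T \<in> completions E F S" "completion_cost E F S w = sum w T"
proof -
  have "completion_cost E F S w \<in> sum w ` completions E F S"
    unfolding completion_cost_def using assms
    by (intro Min_in) (auto simp: finite_completions completions_nonempty)
  then show thesis using that by auto
qed

lemma completion_cost_nonneg:
  assumes "upward_closed_on E F" "S \<subseteq> E" "\<And>i. i \<in> E \<Longrightarrow> 0 \<le> w i"
  shows "0 \<le> completion_cost E F S w"
proof -
  obtain T where "T \<in> completions E F S" "completion_cost E F S w = sum w T"
    using completion_cost_witness assms by metis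
  then show ?thesis
    using assms(3) by (auto simp: completions_def intro!: sum_nonneg)
qed

lemma completion_cost_upd_selected:
  assumes "i \<in> S"
  shows "completion_cost E F S (w(i := x)) = completion_cost E F S w"
proof -
  have "sum (w(i := x)) ` completions E F S = sum w ` completions E F S"
    using assms by (intro image_cong refl sum.cong) (auto simp: completions_def)
  then show ?thesis by (simp add: completion_cost_def)
qed

lemma insert_completions:
  assumes "i \<in> E - S" "T \<in> completions E F (insert i S)"
  shows "insert i T \<in> completions E F S"
  using assms by (auto simp: completions_def)

lemma completion_cost_le_select:
  assumes "upward_closed_on E F" "S \<subseteq> E" "i \<in> E - S"
  shows "completion_cost E F S w \<le> w i + completion_cost E F (insert i S) w"
proof -
  obtain T where T: "T \<in> completions E F (insert i S)"
      "completion_cost E F (insert i S) w = sum w T"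
    using completion_cost_witness[of E F "insert i S" w] assms by auto
  have "finite T" "i \<notin> T"
    using T(1) assms by (auto simp: completions_def upward_closed_on_def intro: finite_subset)
  then have "sum w (insert i T) = w i + sum w T" by simp
  then show ?thesis
    using completion_cost_le[OF assms(1) insert_completions[OF assms(3) T(1)], of w] T(2) by simp
qed

text \<open>Completions avoiding \<open>i\<close> have a cost independent of \<open>x\<close>; a
  cheapest one containing \<open>i\<close> costs \<open>x\<close> plus the completion cost of
  \<open>insert i S\<close>. The minimum of both kinds is \<open>b + min t x\<close>, with
  \<open>b\<close> and \<open>t\<close> independent of \<open>x\<close>.\<close>

lemma completion_cost_coordinate:
  assumes up: "upward_closed_on E F" and S: "S \<subseteq> E" and i: "i \<in> E - S" and K: "0 \<le> K"
  obtains t where "0 \<le> t"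
    and "\<And>x. x \<le> K \<Longrightarrow>
      completion_cost E F S (w(i := x)) = completion_cost E F (insert i S) w + min t x"
proof -
  define C where "C = completion_cost E F (insert i S) w"
  define A where "A = {T \<in> completions E F S. i \<notin> T}"
  \<comment> \<open>\<open>t\<close> is the surplus over \<open>C\<close> of the cheapest completion
    avoiding \<open>i\<close>. If every completion contains \<open>i\<close>, the true threshold is
    infinite, and \<open>K\<close>, a bound on all \<open>x\<close> considered, replaces it.\<close>
  define t where "t = (if A = {} then K else Min (sum w ` A) - C)"
  have finE: "finite E" using up by (simp add: upward_closed_on_def)
  have finA: "finite A" using finite_completions[OF up] by (simp add: A_def)
  \<comment> \<open>Enlarging a feasible set by \<open>i\<close> keeps it feasible, so a completion
    avoiding \<open>i\<close> also completes \<open>insert i S\<close>.\<close>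
  have low: "C \<le> sum w T" if "T \<in> A" for T
  proof -
    have "insert i S \<union> T \<in> F"
      using that up S i unfolding A_def completions_def upward_closed_on_def
      by (metis (no_types, lifting) DiffE Un_insert_left Un_least insert_subset mem_Collect_eq
          subset_Diff_insert subset_insertI Diff_subset order_trans)
    then have "T \<in> completions E F (insert i S)"
      using that by (auto simp: A_def completions_def)
    then show ?thesis using completion_cost_le[OF up] by (auto simp: C_def)
  qed
  have t0: "0 \<le> t"
    using K low finA by (auto simp: t_def)
  have "completion_cost E F S (w(i := x)) = C + min t x" if x: "x \<le> K" for x
  proof (rule antisym)
    have "completion_cost E F S (w(i := x)) \<le> x + C"
      using completion_cost_le_select[OF up S i, of "w(i := x)"]
      by (simp add: C_def completion_cost_upd_selected)
    moreover have "completion_cost E F S (w(i := x)) \<le> C + t" if "A \<noteq> {}"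
    proof -
      have "Min (sum w ` A) \<in> sum w ` A" using finA that by (intro Min_in) auto
      then obtain T where T: "T \<in> A" "Min (sum w ` A) = sum w T" by auto
      have "sum (w(i := x)) T = sum w T" using T by (intro sum.cong) (auto simp: A_def)
      then show ?thesis
        using completion_cost_le[OF up, of T S "w(i := x)"] T that by (auto simp: A_def t_def)
    qed
    ultimately show "completion_cost E F S (w(i := x)) \<le> C + min t x"
      using x by (cases "A = {}") (auto simp: t_def)
  next
    obtain T where T: "T \<in> completions E F S"
        "completion_cost E F S (w(i := x)) = sum (w(i := x)) T"
      using completion_cost_witness[OF up S] by metis
    show "C + min t x \<le> completion_cost E F S (w(i := x))"
    proof (cases "i \<in> T")
      case False
      then have "T \<in> A" using T by (simp add: A_def)
      moreover have "sum (w(i := x)) T = sum w T" using False by (intro sum.cong) auto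
      ultimately have "t \<le> sum (w(i := x)) T - C"
        using finA by (auto simp: t_def)
      then show ?thesis using T(2) by simp
    next
      case True
      have "finite T" using T finE by (auto simp: completions_def intro: finite_subset)
      then have "sum (w(i := x)) T = x + sum (w(i := x)) (T - {i})"
        using True by (simp add: sum.remove)
      moreover have "sum (w(i := x)) (T - {i}) = sum w (T - {i})" by (intro sum.cong) auto
      moreover have "insert i S \<union> (T - {i}) = S \<union> T" using True by auto
      then have "T - {i} \<in> completions E F (insert i S)"
        using T by (auto simp: completions_def)
      then have "C \<le> sum w (T - {i})" using completion_cost_le[OF up] by (auto simp: C_def)
      ultimately show ?thesis using T by auto
    qed
  qed
  with t0 show thesis using that by (simp add: C_def)
qed

section \<open>Matroids and the greedy exchange\<close>

lemma matroid_augment_to_card: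
  assumes "matroid_on E indep" "indep S" "indep T" "card S \<le> card T"
  obtains R where "S \<subseteq> R" "R \<subseteq> S \<union> T" "indep R" "card R = card T"
  using assms
proof (induction "card T - card S" arbitrary: S thesis)
  case 0
  then show ?case by (intro "0.prems"(1)[of S]) auto
next
  case (Suc d)
  then obtain e where e: "e \<in> T - S" "indep (insert e S)"
    unfolding matroid_on_def by (metis zero_less_Suc zero_less_diff)
  have "finite S" using Suc.prems by (meson finite_subset matroid_on_def)
  then have card: "card (insert e S) = Suc (card S)" using e by simp
  show ?case
  proof (rule Suc.hyps(1)[of "insert e S"])
    show "d = card T - card (insert e S)" "card (insert e S) \<le> card T"
      using Suc.hyps(2) card by auto
    fix R assume "insert e S \<subseteq> R" "R \<subseteq> insert e S \<union> T" "indep R" "card R = card T"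
    then show thesis using e by (intro Suc.prems(1)[of R]) auto
  qed (use Suc.prems e in auto)
qed

lemma card_indep_le_basis:
  assumes m: "matroid_on E indep" and B: "is_basis indep B" and R: "indep R"
  shows "card R \<le> card B"
proof (rule ccontr)
  have Bi: "indep B" using B by (simp add: is_basis_def)
  assume "\<not> card R \<le> card B"
  then have "card B < card R" by simp
  with m Bi R have "\<exists>e\<in>R - B. indep (insert e B)" by (simp add: matroid_on_def)
  then obtain e where e: "e \<notin> B" "indep (insert e B)" by blast
  then have "insert e B = B" using B unfolding is_basis_def by (meson subset_insertI)
  then show False using e(1) by blast
qed

lemma is_basis_if_card_eq:
  assumes m: "matroid_on E indep" and B: "is_basis indep B" and R: "indep R" "card R = card B"
  shows "is_basis indep R"
  unfolding is_basis_def
proof (intro conjI allI impI R(1))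
  fix S assume S: "indep S \<and> R \<subseteq> S"
  then have "S \<subseteq> E" "finite E" using m by (simp_all add: matroid_on_def)
  then have "finite S" by (rule finite_subset)
  then have "R = S"
    using S R(2) card_indep_le_basis[OF m B, of S] by (intro card_seteq) auto
  then show "S = R" by simp
qed

lemma matroid_basis_exists:
  assumes "matroid_on E indep"
  obtains B where "is_basis indep B" "B \<subseteq> E"
proof -
  have "{S. indep S} \<subseteq> Pow E" "finite E" using assms by (auto simp: matroid_on_def)
  then have "finite {S. indep S}" by (meson finite_Pow_iff finite_subset)
  moreover have "{} \<in> {S. indep S}" using assms by (simp add: matroid_on_def)
  ultimately obtain B where "indep B" "\<And>S. indep S \<Longrightarrow> B \<subseteq> S \<Longrightarrow> B = S"
    using finite_has_maximal[of "{S. indep S}"] by auto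
  moreover from this have "B \<subseteq> E" using assms by (simp add: matroid_on_def)
  ultimately show thesis by (intro that[of B]) (auto simp: is_basis_def)
qed

lemma upward_closed_contains_basis:
  assumes "matroid_on E indep"
  shows "upward_closed_on E (contains_basis E indep)"
proof -
  obtain B where "is_basis indep B" "B \<subseteq> E" using matroid_basis_exists assms by blast
  moreover have "finite E" using assms by (simp add: matroid_on_def)
  ultimately show ?thesis by (fastforce simp: upward_closed_on_def contains_basis_def)
qed

text \<open>Augmentation towards any basis. It guarantees that the greedy policy always has a
  candidate to continue with.\<close>

lemma not_feasible_extends:
  assumes m: "matroid_on E indep" and "indep S" "S \<notin> contains_basis E indep"
  obtains i where "i \<in> E - S" "indep (insert i S)"
proof -
  have "\<not> is_basis indep S"
    using assms by (auto simp: contains_basis_def matroid_on_def)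
  obtain B where B: "is_basis indep B" "B \<subseteq> E" using matroid_basis_exists m by blast
  then have "card S < card B"
    using card_indep_le_basis[OF m B(1) assms(2)] is_basis_if_card_eq[OF m B(1) assms(2)]
      \<open>\<not> is_basis indep S\<close> by linarith
  moreover have "indep B" using B by (simp add: is_basis_def)
  ultimately have "\<exists>i\<in>B - S. indep (insert i S)"
    using m assms(2) by (simp add: matroid_on_def)
  then show thesis using B(2) that by blast
qed

text \<open>Extend \<open>S\<close> to a basis \<open>B\<close> inside \<open>S \<union> T\<close>,
  then \<open>insert i S\<close> to a basis \<open>R\<close> using elements of \<open>B\<close>. As
  \<open>card R = card B\<close> and \<open>i \<in> R - B\<close>, there is some
  \<open>j \<in> B - R\<close>, and \<open>i\<close> can replace it. Since \<open>insert j S\<close>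
  lies in \<open>B\<close>, it is independent, which makes \<open>j\<close> a competitor of
  \<open>i\<close> in the greedy choice.\<close>

lemma completion_exchange:
  assumes m: "matroid_on E indep" and S: "indep S" and i: "i \<in> E - S" "indep (insert i S)"
    and T: "T \<in> completions E (contains_basis E indep) S" "i \<notin> T"
  obtains j where "j \<in> T" "indep (insert j S)"
    "T - {j} \<in> completions E (contains_basis E indep) (insert i S)"
proof -
  obtain B0 where B0: "is_basis indep B0" "B0 \<subseteq> S \<union> T"
    using T by (auto simp: completions_def contains_basis_def)
  have fin: "finite X" if "indep X" for X
    using m that by (meson finite_subset matroid_on_def)
  have B0i: "indep B0" using B0 by (simp add: is_basis_def)
  obtain B where B: "S \<subseteq> B" "B \<subseteq> S \<union> B0" "indep B" "card B = card B0"
    using matroid_augment_to_card[OF m S B0i card_indep_le_basis[OF m B0(1) S]] by blast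
  obtain R where R: "insert i S \<subseteq> R" "R \<subseteq> insert i S \<union> B" "indep R" "card R = card B"
    using matroid_augment_to_card[OF m i(2) B(3)] card_indep_le_basis[OF m B0(1) i(2)] B(4)
    by metis
  have "i \<notin> B" using i T B B0 by auto
  have "B - R \<noteq> {}"
  proof
    assume "B - R = {}"
    then have "B \<subset> R" using R \<open>i \<notin> B\<close> by auto
    then show False using psubset_card_mono[OF fin[OF R(3)]] R(4) by auto
  qed
  then obtain j where j: "j \<in> B - R" by auto
  have jT: "j \<in> T" using j R(1) B(2) B0(2) by blast
  have "indep (insert j S)" using m B j unfolding matroid_on_def by (metis DiffD1 insert_subset)
  moreover have "R \<subseteq> insert i S \<union> (T - {j})" using R B B0 j by auto
  moreover have "is_basis indep R"
    using is_basis_if_card_eq[OF m B0(1) R(3)] R B by auto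
  moreover have "insert i S \<union> (T - {j}) \<subseteq> E" 
    using i T S m by (auto simp: completions_def matroid_on_def)
  moreover have "T - {j} \<subseteq> E - insert i S" using T by (auto simp: completions_def)
  ultimately show thesis using that[OF jT] unfolding completions_def contains_basis_def by blast
qed

text \<open>A cheapest completion either contains \<open>i\<close> or can trade for it some
  \<open>j\<close> that is at least as heavy.\<close>

lemma completion_cost_greedy:
  assumes m: "matroid_on E indep" and S: "indep S" and i: "i \<in> E - S" "indep (insert i S)"
    and least: "\<And>j. j \<in> E - S \<Longrightarrow> indep (insert j S) \<Longrightarrow> w i \<le> w j"
  shows "completion_cost E (contains_basis E indep) S w =
    w i + completion_cost E (contains_basis E indep) (insert i S) w"
proof (rule antisym)
  let ?F = "contains_basis E indep"
  have up: "upward_closed_on E ?F" using upward_closed_contains_basis[OF m] .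
  have SE: "S \<subseteq> E" using S m by (simp add: matroid_on_def)
  show "completion_cost E ?F S w \<le> w i + completion_cost E ?F (insert i S) w"
    using completion_cost_le_select[OF up SE i(1)] .
  obtain T where T: "T \<in> completions E ?F S" "completion_cost E ?F S w = sum w T"
    using completion_cost_witness[OF up SE] by metis
  have finT: "finite T" using T(1) m by (auto simp: completions_def matroid_on_def intro: finite_subset)
  have "\<exists>j\<in>T. w i \<le> w j \<and> T - {j} \<in> completions E ?F (insert i S)"
  proof (cases "i \<in> T")
    case True
    then have "insert i S \<union> (T - {i}) = S \<union> T" by auto
    then have "T - {i} \<in> completions E ?F (insert i S)"
      using T by (auto simp: completions_def)
    then show ?thesis using True by auto
  next
    case False
    then obtain j where j: "j \<in> T" "indep (insert j S)" "T - {j} \<in> completions E ?F (insert i S)"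
      using completion_exchange[OF m S i T(1)] by blast
    then show ?thesis using least[of j] T(1) by (auto simp: completions_def)
  qed
  then obtain j where j: "j \<in> T" "w i \<le> w j" "T - {j} \<in> completions E ?F (insert i S)" by blast
  have "sum w T = w j + sum w (T - {j})" using finT j(1) by (simp add: sum.remove)
  then show "w i + completion_cost E ?F (insert i S) w \<le> completion_cost E ?F S w"
    using T(2) j(2) completion_cost_le[OF up j(3), of w] by simp
qed


section \<open>Surrogate costs of boxes\<close>

definition action_cost :: "pbpi_box \<Rightarrow> box_action \<Rightarrow> real" where
  "action_cost b a = acost (box_mdp b) Closed a"

definition action_value :: "pbpi_box \<Rightarrow> box_action \<Rightarrow> real pmf" where
  "action_value b a = map_pmf (tval (box_mdp b)) (trans (box_mdp b) Closed a)"

lemma action_cost_simps [simp]: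
  "action_cost b Open = open_cost b" "action_cost b Peek = peek_cost b"
  by (simp_all add: action_cost_def box_mdp_def)

lemma action_value_simps [simp]:
  "action_value b Open = value_dist b"
  "action_value b Peek = map_pmf (\<lambda>x. x + open_cost b) (value_dist b)"
  by (simp_all add: action_value_def box_mdp_def map_pmf_comp)

lemma finite_action_value:
  assumes "valid_box b"
  shows "finite (set_pmf (action_value b a))"
  using assms by (cases a) (auto simp: valid_box_def)

lemma action_value_nonneg:
  assumes "valid_box b" "v \<in> set_pmf (action_value b a)"
  shows "0 \<le> v"
  using assms by (cases a) (auto simp: valid_box_def)

lemma finite_trans:
  assumes "valid_box b"
  shows "finite (set_pmf (trans (box_mdp b) s a))"
  using assms by (cases a) (auto simp: valid_box_def box_mdp_def)

lemma trans_not_Closed: "s' \<in> set_pmf (trans (box_mdp b) s a) \<Longrightarrow> s' \<noteq> Closed"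
  by (cases a) (auto simp: box_mdp_def)

lemma trans_Closed_tval_nonneg:
  assumes "valid_box b" "s' \<in> set_pmf (trans (box_mdp b) Closed a)"
  shows "0 \<le> tval (box_mdp b) s'"
  using action_value_nonneg[OF assms(1), of "tval (box_mdp b) s'" a] assms(2)
  by (auto simp: action_value_def)

lemma acts_box_mdp: "a \<in> acts (box_mdp b) s \<longleftrightarrow> s = Closed"
  by (cases a) (auto simp: box_mdp_def)

lemma terminal_box_mdp: "s \<in> terminal (box_mdp b) \<longleftrightarrow> s \<noteq> Closed"
  by (cases s) (auto simp: box_mdp_def)

lemma init_box_mdp [simp]: "init (box_mdp b) = Closed"
  by (simp add: box_mdp_def)

text \<open>The conditional law of the weight of box \<open>i\<close> given the state reached. The
  factor \<open>\<alpha>\<close> is \<open>4 / 3\<close> for the lower bound and \<open>1\<close>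
  for the greedy policy; the two uses meet in the all-closed state, where \<open>\<alpha>\<close>
  does not occur.\<close>

definition weight_pmf ::
  "real \<Rightarrow> (nat \<Rightarrow> pbpi_box) \<Rightarrow> (nat \<Rightarrow> real pmf) \<Rightarrow> (nat \<Rightarrow> box_state) \<Rightarrow> nat \<Rightarrow> real pmf" where
  "weight_pmf \<alpha> B D s i =
     (if s i = Closed then D i else return_pmf (\<alpha> * tval (box_mdp (B i)) (s i)))"

definition surrogate_cost ::
  "real \<Rightarrow> (nat \<Rightarrow> pbpi_box) \<Rightarrow> (nat \<Rightarrow> real pmf) \<Rightarrow> nat \<Rightarrow> nat set set \<Rightarrow> nat set \<Rightarrow>
     (nat \<Rightarrow> box_state) \<Rightarrow> real" where
  "surrogate_cost \<alpha> B D n F S s =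
     measure_pmf.expectation (Pi_pmf {..<n} 0 (weight_pmf \<alpha> B D s)) (completion_cost {..<n} F S)"

lemma finite_weight_pmf:
  assumes "finite (set_pmf (D i))"
  shows "finite (set_pmf (weight_pmf \<alpha> B D s i))"
  using assms by (simp add: weight_pmf_def)

lemma surrogate_cost_closed:
  assumes "s i = Closed" "i < n" "\<forall>j<n. finite (set_pmf (D j))"
  shows "surrogate_cost \<alpha> B D n F S s =
    measure_pmf.expectation (Pi_pmf ({..<n} - {i}) 0 (weight_pmf \<alpha> B D s))
      (\<lambda>w. measure_pmf.expectation (D i) (\<lambda>x. completion_cost {..<n} F S (w(i := x))))"
proof -
  have "(weight_pmf \<alpha> B D s)(i := D i) = weight_pmf \<alpha> B D s"
    using assms(1) by (auto simp: weight_pmf_def)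
  moreover have "measure_pmf.expectation (Pi_pmf {..<n} 0 ((weight_pmf \<alpha> B D s)(i := D i)))
      (completion_cost {..<n} F S) =
    measure_pmf.expectation (Pi_pmf ({..<n} - {i}) 0 (weight_pmf \<alpha> B D s))
      (\<lambda>w. measure_pmf.expectation (D i) (\<lambda>x. completion_cost {..<n} F S (w(i := x))))"
    using assms(2,3) by (intro expectation_Pi_pmf_coordinate finite_weight_pmf) auto
  ultimately show ?thesis by (simp add: surrogate_cost_def)
qed

text \<open>Inspecting box \<open>i\<close> leaves the law of the other weights unchanged, so
  swapping the expectations yields the same outer law as in \<open>surrogate_cost_closed\<close>.
  Comparing the states before and after the action thus reduces to one box with all other weights
  fixed.\<close>

lemma surrogate_cost_after_action:
  assumes "i < n" "\<forall>j<n. finite (set_pmf (D j))" "valid_box (B i)"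
  shows "measure_pmf.expectation (trans (box_mdp (B i)) Closed a)
      (\<lambda>s'. surrogate_cost \<alpha> B D n F S (s(i := s'))) =
    measure_pmf.expectation (Pi_pmf ({..<n} - {i}) 0 (weight_pmf \<alpha> B D s))
      (\<lambda>w. measure_pmf.expectation (action_value (B i) a)
        (\<lambda>v. completion_cost {..<n} F S (w(i := \<alpha> * v))))"
    (is "measure_pmf.expectation ?tr _ = measure_pmf.expectation ?R _")
proof -
  have "surrogate_cost \<alpha> B D n F S (s(i := s')) =
      measure_pmf.expectation ?R
        (\<lambda>w. completion_cost {..<n} F S (w(i := \<alpha> * tval (box_mdp (B i)) s')))"
    if "s' \<in> set_pmf ?tr" for s'
  proof -
    have "weight_pmf \<alpha> B D (s(i := s')) =
        (weight_pmf \<alpha> B D s)(i := return_pmf (\<alpha> * tval (box_mdp (B i)) s'))"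
      using trans_not_Closed[OF that] by (auto simp: weight_pmf_def fun_eq_iff)
    moreover have "measure_pmf.expectation
        (Pi_pmf {..<n} 0 ((weight_pmf \<alpha> B D s)(i := return_pmf (\<alpha> * tval (box_mdp (B i)) s'))))
        (completion_cost {..<n} F S) =
      measure_pmf.expectation ?R
        (\<lambda>w. measure_pmf.expectation (return_pmf (\<alpha> * tval (box_mdp (B i)) s'))
          (\<lambda>x. completion_cost {..<n} F S (w(i := x))))"
      using assms by (intro expectation_Pi_pmf_coordinate finite_weight_pmf) auto
    ultimately show ?thesis by (simp add: surrogate_cost_def)
  qed
  then have "measure_pmf.expectation ?tr (\<lambda>s'. surrogate_cost \<alpha> B D n F S (s(i := s'))) =
      measure_pmf.expectation ?tr (\<lambda>s'. measure_pmf.expectation ?R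
        (\<lambda>w. completion_cost {..<n} F S (w(i := \<alpha> * tval (box_mdp (B i)) s'))))"
    by (rule expectation_cong)
  also have "\<dots> = measure_pmf.expectation ?R (\<lambda>w. measure_pmf.expectation ?tr
        (\<lambda>s'. completion_cost {..<n} F S (w(i := \<alpha> * tval (box_mdp (B i)) s'))))"
    using assms
    by (intro expectation_swap_finite finite_trans finite_set_Pi_pmf finite_weight_pmf) auto
  finally show ?thesis by (simp add: action_value_def)
qed

section \<open>Lower bound on the cost of any policy\<close>

text \<open>Induction over the decision tree: no step lowers the potential, on average, by more than
  \<open>\<alpha>\<close> times its cost, and at \<open>Stop\<close> the empty completion shows that
  the potential is at most 0.\<close>

lemma surrogate_cost_le_exp_cost:
  assumes up: "upward_closed_on {..<n} F" and \<alpha>: "0 \<le> \<alpha>"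
    and valid: "\<And>i. i < n \<Longrightarrow> valid_box (B i)"
    and fin: "\<And>i. i < n \<Longrightarrow> finite (set_pmf (D i))"
    and nonneg: "\<And>i x. i < n \<Longrightarrow> x \<in> set_pmf (D i) \<Longrightarrow> 0 \<le> x"
    and local: "\<And>i a t. i < n \<Longrightarrow> 0 \<le> t \<Longrightarrow>
      measure_pmf.expectation (D i) (min t) \<le> \<alpha> * action_cost (B i) a +
        measure_pmf.expectation (action_value (B i) a) (\<lambda>v. min t (\<alpha> * v))"
  shows "S \<subseteq> {..<n} \<Longrightarrow> feasible (\<lambda>i. box_mdp (B i)) n F p S s \<Longrightarrow>
    surrogate_cost \<alpha> B D n F S s \<le> \<alpha> * exp_cost (\<lambda>i. box_mdp (B i)) p s"
proof (induction p arbitrary: S s)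
  case Stop
  have fin_w: "finite (set_pmf (Pi_pmf {..<n} 0 (weight_pmf \<alpha> B D s)))"
    by (intro finite_set_Pi_pmf finite_weight_pmf fin) auto
  have "{} \<in> completions {..<n} F S" using Stop by (auto simp: completions_def)
  then have "completion_cost {..<n} F S w \<le> 0" for w
    using completion_cost_le[OF up, of "{}" S w] by simp
  then have "surrogate_cost \<alpha> B D n F S s \<le>
      measure_pmf.expectation (Pi_pmf {..<n} 0 (weight_pmf \<alpha> B D s)) (\<lambda>_. 0)"
    unfolding surrogate_cost_def by (intro expectation_mono_finite fin_w)
  then show ?case by simp
next
  case (Select i p)
  have i: "i \<in> {..<n} - S" "s i \<noteq> Closed" "feasible (\<lambda>i. box_mdp (B i)) n F p (insert i S) s"
    using Select.prems by (auto simp: terminal_box_mdp)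
  have fin_w: "finite (set_pmf (Pi_pmf {..<n} 0 (weight_pmf \<alpha> B D s)))"
    by (intro finite_set_Pi_pmf finite_weight_pmf fin) auto
  have "surrogate_cost \<alpha> B D n F S s \<le>
      measure_pmf.expectation (Pi_pmf {..<n} 0 (weight_pmf \<alpha> B D s))
        (\<lambda>w. \<alpha> * tval (box_mdp (B i)) (s i) + completion_cost {..<n} F (insert i S) w)"
    unfolding surrogate_cost_def
  proof (intro expectation_mono_finite fin_w)
    fix w assume "w \<in> set_pmf (Pi_pmf {..<n} 0 (weight_pmf \<alpha> B D s))"
    then have "w i = \<alpha> * tval (box_mdp (B i)) (s i)"
      using i by (auto simp: set_Pi_pmf PiE_dflt_def weight_pmf_def)
    then show "completion_cost {..<n} F S w \<le>
        \<alpha> * tval (box_mdp (B i)) (s i) + completion_cost {..<n} F (insert i S) w"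
      using completion_cost_le_select[OF up Select.prems(1) i(1), of w] by simp
  qed
  also have "\<dots> = \<alpha> * tval (box_mdp (B i)) (s i) + surrogate_cost \<alpha> B D n F (insert i S) s"
    unfolding surrogate_cost_def by (rule expectation_const_add[OF fin_w])
  also have "surrogate_cost \<alpha> B D n F (insert i S) s \<le> \<alpha> * exp_cost (\<lambda>i. box_mdp (B i)) p s"
    using Select.IH[of "insert i S" s] i Select.prems(1) by auto
  finally show ?case by (simp add: distrib_left)
next
  case (Act i a k)
  let ?tr = "trans (box_mdp (B i)) Closed a"
  let ?R = "Pi_pmf ({..<n} - {i}) 0 (weight_pmf \<alpha> B D s)"
  let ?G = "completion_cost {..<n} F S"
  have i: "i < n" "s i = Closed"
    and feas: "\<And>s'. s' \<in> set_pmf ?tr \<Longrightarrow>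
      feasible (\<lambda>i. box_mdp (B i)) n F (k s') S (s(i := s'))"
    using Act.prems by (auto simp: acts_box_mdp)
  have fin_R: "finite (set_pmf ?R)"
    by (intro finite_set_Pi_pmf finite_weight_pmf fin) auto
  have fin_tr: "finite (set_pmf ?tr)" using finite_trans valid i by blast
  have fin_all: "\<forall>j<n. finite (set_pmf (D j))" using fin by blast
  have fin_v: "finite (set_pmf (action_value (B i) a))" using finite_action_value valid i by blast
  have one_box: "measure_pmf.expectation (D i) (\<lambda>x. ?G (w(i := x))) \<le>
      \<alpha> * action_cost (B i) a +
      measure_pmf.expectation (action_value (B i) a) (\<lambda>v. ?G (w(i := \<alpha> * v)))" for w
  proof -
    \<comment> \<open>All weights of box \<open>i\<close> that occur before or after the action; the
      set is finite, so its maximum provides the bound \<open>K\<close> for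
      \<open>completion_cost_coordinate\<close>.\<close>
    define X where "X = set_pmf (D i) \<union> (\<lambda>v. \<alpha> * v) ` set_pmf (action_value (B i) a)"
    have "finite X" using fin i fin_v by (simp add: X_def)
    have X: "0 \<le> x" if "x \<in> X" for x
      using that nonneg i \<alpha> action_value_nonneg[OF valid[OF i(1)]] by (auto simp: X_def)
    define K where "K = Max (insert 0 X)"
    have K: "0 \<le> K" "\<And>x. x \<in> X \<Longrightarrow> x \<le> K"
      using \<open>finite X\<close> by (auto simp: K_def)
    obtain b t where t: "0 \<le> t" and G: "\<And>x. x \<in> X \<Longrightarrow> ?G (w(i := x)) = b + min t x"
    proof (cases "i \<in> S")
      \<comment> \<open>The induction ranges over arbitrary joint states, so a selected box may
        still be closed. Its weight is irrelevant, and \<open>t = 0\<close> fits because the weights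
        are nonnegative.\<close>
      case True
      then have "?G (w(i := x)) = ?G w + min 0 x" if "x \<in> X" for x
        using X[OF that] by (simp add: completion_cost_upd_selected)
      then show thesis using that by (metis order_refl)
    next
      case False
      then have "i \<in> {..<n} - S" using i by simp
      then show thesis
        using completion_cost_coordinate[OF up Act.prems(1) _ K(1), of i w] K(2) that by metis
    qed
    have "measure_pmf.expectation (D i) (\<lambda>x. ?G (w(i := x))) =
        measure_pmf.expectation (D i) (\<lambda>x. b + min t x)"
      by (rule expectation_cong, rule G) (simp add: X_def)
    also have "\<dots> = b + measure_pmf.expectation (D i) (min t)"
      using expectation_const_add fin i by blast
    also have "\<dots> \<le> \<alpha> * action_cost (B i) a +
        (b + measure_pmf.expectation (action_value (B i) a) (\<lambda>v. min t (\<alpha> * v)))"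
      using local[OF i(1) t, of a] by simp
    also have "b + measure_pmf.expectation (action_value (B i) a) (\<lambda>v. min t (\<alpha> * v)) =
        measure_pmf.expectation (action_value (B i) a) (\<lambda>v. b + min t (\<alpha> * v))"
      by (rule expectation_const_add[symmetric, OF fin_v])
    also have "\<dots> = measure_pmf.expectation (action_value (B i) a) (\<lambda>v. ?G (w(i := \<alpha> * v)))"
      by (rule expectation_cong, rule G[symmetric]) (auto simp: X_def)
    finally show ?thesis .
  qed
  have "surrogate_cost \<alpha> B D n F S s \<le>
      measure_pmf.expectation ?R (\<lambda>w. \<alpha> * action_cost (B i) a +
        measure_pmf.expectation (action_value (B i) a) (\<lambda>v. ?G (w(i := \<alpha> * v))))"
    unfolding surrogate_cost_closed[where s = s and D = D and i = i, OF i(2,1) fin_all]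
    by (intro expectation_mono_finite fin_R one_box)
  also have "\<dots> = \<alpha> * action_cost (B i) a +
      measure_pmf.expectation ?tr (\<lambda>s'. surrogate_cost \<alpha> B D n F S (s(i := s')))"
    unfolding surrogate_cost_after_action[where B = B and D = D and i = i, OF i(1) fin_all valid[OF i(1)]]
    by (rule expectation_const_add[OF fin_R])
  also have "\<dots> \<le> \<alpha> * action_cost (B i) a + measure_pmf.expectation ?tr
      (\<lambda>s'. \<alpha> * exp_cost (\<lambda>i. box_mdp (B i)) (k s') (s(i := s')))"
    using Act.IH[OF rangeI Act.prems(1) feas]
    by (intro add_left_mono expectation_mono_finite fin_tr)
  finally show ?case by (simp add: i action_cost_def distrib_left)
qed

section \<open>The greedy index policy of a committed instance\<close>

text \<open>Each step uses up an unselected element or a closed box, whence the induction measure.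
  On average the potential falls in each step by exactly the cost paid; the inequality arises only
  at \<open>Stop\<close>, where the remaining potential is nonnegative because terminal values
  are.\<close>

lemma committed_policy_exists:
  fixes B :: "nat \<Rightarrow> pbpi_box" and c :: "nat \<Rightarrow> box_action" and g :: "nat \<Rightarrow> real"
  defines "D \<equiv> \<lambda>i. map_pmf (max (g i)) (action_value (B i) (c i))"
    and "M \<equiv> \<lambda>i. restrict_mdp (box_mdp (B i)) (c i)"
  assumes m: "matroid_on {..<n} indep"
    and valid: "\<And>i. i < n \<Longrightarrow> valid_box (B i)"
    and g: "\<And>i. i < n \<Longrightarrow>
      measure_pmf.expectation (action_value (B i) (c i)) (\<lambda>v. max (g i - v) 0) =
      action_cost (B i) (c i)"
  shows "indep S \<Longrightarrow> (\<And>i. i < n \<Longrightarrow> 0 \<le> tval (box_mdp (B i)) (s i)) \<Longrightarrow>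
    \<exists>p. feasible M n (contains_basis {..<n} indep) p S s \<and>
        exp_cost M p s \<le> surrogate_cost 1 B D n (contains_basis {..<n} indep) S s"
proof (induction "card ({..<n} - S) + card {i \<in> {..<n}. s i = Closed}" arbitrary: S s
    rule: less_induct)
  case less
  let ?F = "contains_basis {..<n} indep"
  let ?G = "completion_cost {..<n} ?F"
  let ?P = "weight_pmf 1 B D s"
  have up: "upward_closed_on {..<n} ?F" using upward_closed_contains_basis[OF m] .
  have SE: "S \<subseteq> {..<n}" using less.prems(1) m by (simp add: matroid_on_def)
  have fin: "finite (set_pmf (D i))" if "i < n" for i
    using finite_action_value[OF valid[OF that]] by (simp add: D_def)
  have fin_w: "finite (set_pmf (Pi_pmf A 0 ?P))" if "A \<subseteq> {..<n}" for A
    using that by (intro finite_set_Pi_pmf finite_weight_pmf fin) (auto intro: finite_subset)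
  \<comment> \<open>A lower bound on the weight in every outcome, and the exact weight once the box
    is inspected.\<close>
  define idx where "idx i = (if s i = Closed then g i else tval (box_mdp (B i)) (s i))" for i
  have idx_le: "idx j \<le> w j" if "w \<in> set_pmf (Pi_pmf A 0 ?P)" "j \<in> A" "A \<subseteq> {..<n}" for w j A
  proof -
    have "finite A" using that finite_subset by blast
    then have "w j \<in> set_pmf (?P j)" using that by (auto simp: set_Pi_pmf PiE_dflt_def)
    then show ?thesis by (auto simp: weight_pmf_def idx_def D_def split: if_splits)
  qed
  show ?case
  proof (cases "S \<in> ?F")
    case True
    have "0 \<le> measure_pmf.expectation (Pi_pmf {..<n} 0 ?P) (?G S)"
    proof -
      have "0 \<le> ?G S w" if w: "w \<in> set_pmf (Pi_pmf {..<n} 0 ?P)" for w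
      proof (rule completion_cost_nonneg[OF up SE])
        fix i assume i: "i \<in> {..<n}"
        then have "w i \<in> set_pmf (?P i)" using w by (auto simp: set_Pi_pmf PiE_dflt_def)
        then show "0 \<le> w i"
          using less.prems(2)[of i] i action_value_nonneg[OF valid, of i]
          by (auto simp: weight_pmf_def D_def le_max_iff_disj split: if_splits)
      qed
      then have "measure_pmf.expectation (Pi_pmf {..<n} 0 ?P) (\<lambda>_. 0) \<le>
          measure_pmf.expectation (Pi_pmf {..<n} 0 ?P) (?G S)"
        by (intro expectation_mono_finite fin_w) auto
      then show ?thesis by simp
    qed
    then show ?thesis
      using True by (intro exI[of _ Stop]) (simp add: surrogate_cost_def)
  next
    case False
    define L where "L = {i \<in> {..<n} - S. indep (insert i S)}"
    have "finite L" by (simp add: L_def)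
    moreover have "L \<noteq> {}"
      using not_feasible_extends[OF m less.prems(1) False] by (auto simp: L_def)
    ultimately have "Min (idx ` L) \<in> idx ` L" by (intro Min_in) auto
    then obtain i where "i \<in> L" and "idx i = Min (idx ` L)" by auto
    then have least: "idx i \<le> idx j" if "j \<in> L" for j using that \<open>finite L\<close> by simp
    have i: "i \<in> {..<n} - S" "indep (insert i S)" "i < n" using \<open>i \<in> L\<close> by (auto simp: L_def)
    \<comment> \<open>If the weight of \<open>i\<close> equals its index, then \<open>i\<close> is
      lightest among the candidates in \<open>L\<close>, whatever the other weights turn out to
      be.\<close>
    have greedy: "?G S w = idx i + ?G (insert i S) w"
      if "w i = idx i" "\<And>j. j \<in> {..<n} - {i} \<Longrightarrow> idx j \<le> w j" for w
    proof -
      have "w i \<le> w j" if "j \<in> {..<n} - S" "indep (insert j S)" for j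
        using least[of j] that \<open>w i = idx i\<close> \<open>\<And>j. j \<in> {..<n} - {i} \<Longrightarrow> idx j \<le> w j\<close>[of j]
        by (cases "j = i") (auto simp: L_def)
      then show ?thesis
        using completion_cost_greedy[OF m less.prems(1) i(1,2), of w] that(1) by simp
    qed
    show ?thesis
    proof (cases "s i = Closed")
      case open_box: False
      have "card ({..<n} - insert i S) < card ({..<n} - S)"
        using i by (intro psubset_card_mono) auto
      then obtain p where p: "feasible M n ?F p (insert i S) s"
          "exp_cost M p s \<le> surrogate_cost 1 B D n ?F (insert i S) s"
        using less.hyps[of "insert i S" s] i less.prems(2) by auto
      have "surrogate_cost 1 B D n ?F S s =
          measure_pmf.expectation (Pi_pmf {..<n} 0 ?P) (\<lambda>w. idx i + ?G (insert i S) w)"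
        unfolding surrogate_cost_def
      proof (rule expectation_cong)
        fix w assume w: "w \<in> set_pmf (Pi_pmf {..<n} 0 ?P)"
        then have "w i \<in> set_pmf (?P i)" using i by (auto simp: set_Pi_pmf PiE_dflt_def)
        then have "w i = idx i" using open_box by (simp add: weight_pmf_def idx_def)
        then show "?G S w = idx i + ?G (insert i S) w"
          using idx_le[OF w] by (intro greedy) auto
      qed
      also have "\<dots> = idx i + surrogate_cost 1 B D n ?F (insert i S) s"
        unfolding surrogate_cost_def by (rule expectation_const_add[OF fin_w[OF order_refl]])
      finally have "exp_cost M (Select i p) s \<le> surrogate_cost 1 B D n ?F S s"
        using p(2) open_box by (simp add: idx_def M_def restrict_mdp_def)
      moreover have "feasible M n ?F (Select i p) S s"
        using p(1) open_box False i terminal_box_mdp[of "s i" "B i"]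
        by (simp add: M_def restrict_mdp_def)
      ultimately show ?thesis by blast
    next
      case closed: True
      let ?tr = "trans (box_mdp (B i)) Closed (c i)"
      let ?V = "action_value (B i) (c i)"
      let ?R = "Pi_pmf ({..<n} - {i}) 0 ?P"
      have fin_R: "finite (set_pmf ?R)" by (intro fin_w) auto
      have fin_tr: "finite (set_pmf ?tr)" using finite_trans valid i by blast
      have fin_all: "\<forall>j<n. finite (set_pmf (D j))" using fin by blast
      have fin_V: "finite (set_pmf ?V)" using finite_action_value valid i by blast
      have "\<exists>p. feasible M n ?F p S (s(i := s')) \<and>
          exp_cost M p (s(i := s')) \<le> surrogate_cost 1 B D n ?F S (s(i := s'))"
        if s': "s' \<in> set_pmf ?tr" for s'
      proof (rule less.hyps[OF _ less.prems(1)])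
        have "{j \<in> {..<n}. (s(i := s')) j = Closed} \<subset> {j \<in> {..<n}. s j = Closed}"
          using trans_not_Closed[OF s'] closed i(3) by (auto split: if_splits)
        then have "card {j \<in> {..<n}. (s(i := s')) j = Closed} < card {j \<in> {..<n}. s j = Closed}"
          by (intro psubset_card_mono) auto
        then show "card ({..<n} - S) + card {j \<in> {..<n}. (s(i := s')) j = Closed} <
            card ({..<n} - S) + card {j \<in> {..<n}. s j = Closed}"
          by simp
        show "0 \<le> tval (box_mdp (B j)) ((s(i := s')) j)" if "j < n" for j
          using less.prems(2)[OF that] trans_Closed_tval_nonneg[OF valid[OF i(3)] s'] by simp
      qed
      then obtain k where k: "\<And>s'. s' \<in> set_pmf ?tr \<Longrightarrow> feasible M n ?F (k s') S (s(i := s'))"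
          "\<And>s'. s' \<in> set_pmf ?tr \<Longrightarrow>
            exp_cost M (k s') (s(i := s')) \<le> surrogate_cost 1 B D n ?F S (s(i := s'))"
        by metis
      have one_box: "action_cost (B i) (c i) +
          measure_pmf.expectation ?V (\<lambda>v. ?G S (w(i := 1 * v))) =
          measure_pmf.expectation (D i) (\<lambda>x. ?G S (w(i := x)))" if w: "w \<in> set_pmf ?R" for w
      proof -
        define X where "X = insert 0 (insert (g i) (set_pmf ?V \<union> max (g i) ` set_pmf ?V))"
        have "finite X" using fin_V by (simp add: X_def)
        then have K: "x \<le> Max X" if "x \<in> X" for x using that by simp
        obtain t where G: "\<And>x. x \<le> Max X \<Longrightarrow> ?G S (w(i := x)) = ?G (insert i S) w + min t x"
          using completion_cost_coordinate[OF up SE i(1), of "Max X" w] K[of 0]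
          by (auto simp: X_def)
        \<comment> \<open>At weight \<open>g i\<close> box \<open>i\<close> is a greedy choice,
          which forces its threshold \<open>t\<close> to be at least its index.\<close>
        have "?G S (w(i := g i)) = g i + ?G (insert i S) (w(i := g i))"
          using greedy[of "w(i := g i)"] idx_le[OF w] closed by (simp add: idx_def)
        then have "min t (g i) = g i"
          using G[of "g i"] K[of "g i"] by (simp add: X_def completion_cost_upd_selected)
        then have t: "g i \<le> t" by simp
        have "measure_pmf.expectation (D i) (\<lambda>x. ?G S (w(i := x))) =
            measure_pmf.expectation ?V (\<lambda>v. ?G S (w(i := max (g i) v)))"
          by (simp add: D_def)
        \<comment> \<open>As \<open>g i \<le> t\<close>, capping at \<open>t\<close> does not touch
          the excess \<open>max (g i - v) 0\<close>. Its expectation is the action cost by the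
          choice of the index, so the inspection is paid for exactly.\<close>
        also have "\<dots> = measure_pmf.expectation ?V (\<lambda>v. max (g i - v) 0 + ?G S (w(i := 1 * v)))"
        proof (rule expectation_cong)
          fix v assume v: "v \<in> set_pmf ?V"
          then have "v \<in> X" "max (g i) v \<in> X" by (auto simp: X_def)
          then show "?G S (w(i := max (g i) v)) = max (g i - v) 0 + ?G S (w(i := 1 * v))"
            using G[of v] G[of "max (g i) v"] K[of v] K[of "max (g i) v"] t by auto
        qed
        finally show ?thesis
          using g[OF i(3)] fin_V by (simp add: expectation_add_finite)
      qed
      have "exp_cost M (Act i (c i) k) s = action_cost (B i) (c i) +
          measure_pmf.expectation ?tr (\<lambda>s'. exp_cost M (k s') (s(i := s')))"
        using closed by (simp add: M_def restrict_mdp_def action_cost_def)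
      also have "\<dots> \<le> action_cost (B i) (c i) +
          measure_pmf.expectation ?tr (\<lambda>s'. surrogate_cost 1 B D n ?F S (s(i := s')))"
        using k(2) by (intro add_left_mono expectation_mono_finite fin_tr) auto
      also have "\<dots> = measure_pmf.expectation ?R (\<lambda>w. action_cost (B i) (c i) +
          measure_pmf.expectation ?V (\<lambda>v. ?G S (w(i := 1 * v))))"
        unfolding surrogate_cost_after_action[where B = B and D = D and i = i, OF i(3) fin_all valid[OF i(3)]]
        by (rule expectation_const_add[symmetric, OF fin_R])
      also have "\<dots> = surrogate_cost 1 B D n ?F S s"
        unfolding surrogate_cost_closed[where s = s and D = D and i = i, OF closed i(3) fin_all]
        by (rule expectation_cong) (rule one_box)
      finally have "exp_cost M (Act i (c i) k) s \<le> surrogate_cost 1 B D n ?F S s" .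
      moreover have "feasible M n ?F (Act i (c i) k) S s"
        using k(1) closed False i(3) acts_box_mdp[of "c i" "B i" Closed]
        by (simp add: M_def restrict_mdp_def)
      ultimately show ?thesis by blast
    qed
  qed
qed


section \<open>Mixing the two actions of a box\<close>

text \<open>Intermediate value theorem on \<open>[0, K]\<close>: at 0 the expectation vanishes as
  values are nonnegative, and \<open>K\<close> exceeds every value by at least
  \<open>a\<close>.\<close>

lemma index_exists:
  fixes V :: "real pmf"
  assumes fin: "finite (set_pmf V)" and nonneg: "\<And>v. v \<in> set_pmf V \<Longrightarrow> 0 \<le> v" and a: "0 \<le> a"
  obtains g where "measure_pmf.expectation V (\<lambda>v. max (g - v) 0) = a"
proof -
  define f where "f g = measure_pmf.expectation V (\<lambda>v. max (g - v) 0)" for g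
  have f: "f g = (\<Sum>v\<in>set_pmf V. pmf V v * max (g - v) 0)" for g
    unfolding f_def using fin by (subst integral_measure_pmf[of "set_pmf V"]) simp_all
  have cont: "continuous_on X f" for X
    unfolding f by (intro continuous_intros)
  define K where "K = Max (set_pmf V) + a"
  have le: "v + a \<le> K" if "v \<in> set_pmf V" for v
    using fin that by (simp add: K_def)
  obtain v where "v \<in> set_pmf V" using set_pmf_not_empty[of V] by blast
  then have K: "0 \<le> K" using le[of v] nonneg[of v] a by linarith
  have "f 0 = measure_pmf.expectation V (\<lambda>_. 0)"
    unfolding f_def by (rule expectation_cong) (use nonneg in auto)
  then have f0: "f 0 \<le> a" using a by simp
  have "measure_pmf.expectation V (\<lambda>_. a) \<le> f K"
    unfolding f_def using fin by (rule expectation_mono_finite) (use le in fastforce)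
  then have "a \<le> f K" by simp
  then obtain g where "f g = a" using IVT'[of f 0 a K] f0 K cont by blast
  then show thesis using that by (simp add: f_def)
qed

text \<open>For \<open>h = 2 * c\<close> the two constraints force a factor of at least
  \<open>4 / 3\<close>, so the constant is the best one for this pair of conditions.\<close>

lemma mixing_probability_exists:
  fixes c h :: real
  assumes "0 < c" "c \<le> h"
  obtains q where "0 \<le> q" "q \<le> 1" "q * c \<le> (4 / 3 - 1) * h" "(1 - q) * h + q * c \<le> 4 / 3 * c"
proof (cases "3 * c \<le> h")
  case True
  then show ?thesis using assms by (intro that[of 1]) auto
next
  case False
  \<comment> \<open>This choice turns the first constraint into an equality.\<close>
  define q where "q = h / (3 * c)"
  have qc: "q * c = h / 3" using assms by (simp add: q_def)
  have q: "0 \<le> q" "q \<le> 1" using False assms by (simp_all add: q_def)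
  have "0 \<le> (2 * c - h)\<^sup>2" by simp
  then have "4 * (h * c) - h * h \<le> 4 * (c * c)"
    by (simp add: power2_eq_square algebra_simps)
  then have "(1 - q) * h + h / 3 \<le> 4 / 3 * c"
    using assms by (simp add: q_def field_simps)
  with q qc show ?thesis by (intro that[of q]) auto
qed

definition random_action :: "real \<Rightarrow> box_action pmf" where
  "random_action q = map_pmf (\<lambda>b. if b then Peek else Open) (bernoulli_pmf q)"

lemma finite_box_actions: "finite (A :: box_action set)"
proof (rule finite_subset)
  show "A \<subseteq> {Open, Peek}" using box_action.exhaust by blast
qed simp

lemma finite_random_action: "finite (set_pmf (random_action q))"
  by (rule finite_box_actions)

lemma expectation_random_action:
  fixes f :: "box_action \<Rightarrow> real"
  assumes "0 \<le> q" "q \<le> 1"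
  shows "measure_pmf.expectation (random_action q) f = q * f Peek + (1 - q) * f Open"
  using assms by (simp add: random_action_def)

text \<open>Replacing \<open>max (g a) v\<close> by \<open>v\<close> costs at most the expected
  excess, which is the action cost. The indices thereby disappear, and only costs and capped values
  remain to be compared.\<close>

lemma mixture_local_approximation:
  assumes valid: "valid_box b" and q: "0 \<le> q" "q \<le> 1"
    and q_open: "q * peek_cost b \<le> (\<alpha> - 1) * open_cost b"
    and q_peek: "(1 - q) * open_cost b + q * peek_cost b \<le> \<alpha> * peek_cost b"
    and \<alpha>: "1 \<le> \<alpha>"
    and g: "\<And>a. measure_pmf.expectation (action_value b a) (\<lambda>v. max (g a - v) 0) = action_cost b a"
  shows "measure_pmf.expectation
      (bind_pmf (random_action q) (\<lambda>a. map_pmf (max (g a)) (action_value b a))) (min t) \<le>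
    \<alpha> * action_cost b a' + measure_pmf.expectation (action_value b a') (\<lambda>v. min t (\<alpha> * v))"
proof -
  let ?X = "value_dist b"
  let ?h = "open_cost b" and ?c = "peek_cost b"
  let ?E = "measure_pmf.expectation"
  have fin: "finite (set_pmf ?X)" and nonneg: "\<And>x. x \<in> set_pmf ?X \<Longrightarrow> 0 \<le> x"
    and h: "0 < ?h"
    using valid by (auto simp: valid_box_def)
  have one: "?E (map_pmf (max (g a)) (action_value b a)) (min t) \<le>
      action_cost b a + ?E (action_value b a) (min t)" for a
  proof -
    have fin_v: "finite (set_pmf (action_value b a))" by (rule finite_action_value[OF valid])
    have "?E (action_value b a) (\<lambda>v. min t (max (g a) v)) \<le>
        ?E (action_value b a) (\<lambda>v. max (g a - v) 0 + min t v)"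
      by (intro expectation_mono_finite fin_v) auto
    then show ?thesis using g[of a] fin_v by (simp add: expectation_add_finite)
  qed
  define Eo where "Eo = ?E ?X (min t)"
  define Ep where "Ep = ?E ?X (\<lambda>x. min t (x + ?h))"
  have "?E (bind_pmf (random_action q) (\<lambda>a. map_pmf (max (g a)) (action_value b a))) (min t) =
      q * ?E (map_pmf (max (g Peek)) (action_value b Peek)) (min t) +
      (1 - q) * ?E (map_pmf (max (g Open)) (action_value b Open)) (min t)"
    using finite_action_value[OF valid] q
    by (subst expectation_bind_finite)
       (simp_all only: finite_random_action set_map_pmf finite_imageI expectation_random_action)
  also have "\<dots> \<le> q * (?c + Ep) + (1 - q) * (?h + Eo)"
    using one[of Peek] one[of Open] q
    by (intro add_mono mult_left_mono) (simp_all add: Eo_def Ep_def)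
  also have "\<dots> = ((1 - q) * ?h + q * ?c) + (q * Ep + (1 - q) * Eo)"
    by (simp add: algebra_simps)
  finally have main: "?E (bind_pmf (random_action q) (\<lambda>a. map_pmf (max (g a)) (action_value b a)))
      (min t) \<le> ((1 - q) * ?h + q * ?c) + (q * Ep + (1 - q) * Eo)" .
  show ?thesis
  proof (cases a')
    case Open
    \<comment> \<open>Compared with opening, the peeking branch carries the opening cost in its
      terminal value as well; the total charge \<open>?h + q * ?c\<close> is at most
      \<open>\<alpha> * ?h\<close> by \<open>q_open\<close>.\<close>
    have "Ep \<le> ?E ?X (\<lambda>x. ?h + min t x)"
      unfolding Ep_def using h by (intro expectation_mono_finite fin) auto
    then have "Ep \<le> ?h + Eo" by (simp add: Eo_def expectation_const_add[OF fin])
    then have "q * Ep \<le> q * (?h + Eo)" using q by (intro mult_left_mono)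
    moreover have "Eo \<le> ?E ?X (\<lambda>x. min t (\<alpha> * x))"
      unfolding Eo_def
    proof (intro expectation_mono_finite fin)
      fix x assume "x \<in> set_pmf ?X"
      then have "1 * x \<le> \<alpha> * x" using nonneg \<alpha> by (intro mult_right_mono)
      then show "min t x \<le> min t (\<alpha> * x)" by auto
    qed
    ultimately show ?thesis using main q_open Open by (simp add: algebra_simps)
  next
    case Peek
    define Ea where "Ea = ?E ?X (\<lambda>x. min t (\<alpha> * (x + ?h)))"
    have le: "x + ?h \<le> \<alpha> * (x + ?h)" if "x \<in> set_pmf ?X" for x
      using mult_right_mono[OF \<alpha>, of "x + ?h"] nonneg[OF that] h by simp
    \<comment> \<open>Compared with peeking, neither branch has a larger capped value, so only the
      action costs are left, and \<open>q_peek\<close> bounds them.\<close>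
    have "Ep \<le> Ea" "Eo \<le> Ea"
      unfolding Ep_def Eo_def Ea_def
      by (intro expectation_mono_finite fin; use le h in fastforce)+
    then have "q * Ep + (1 - q) * Eo \<le> q * Ea + (1 - q) * Ea"
      using q by (intro add_mono mult_left_mono) auto
    also have "\<dots> = Ea" by (simp add: algebra_simps)
    finally show ?thesis using main q_peek Peek by (simp add: Ea_def)
  qed
qed

section \<open>Restricted instances and the bound on the commitment gap\<close>

lemma feasible_restrict_mdp:
  "feasible (\<lambda>i. restrict_mdp (M i) (c i)) n F p S s \<Longrightarrow> feasible M n F p S s"
  by (induction p arbitrary: S s) (auto simp: restrict_mdp_def)

text \<open>A restriction changes only which actions are available, so committed and arbitrary
  policies can be compared by their cost in the unrestricted instance.\<close>

lemma exp_cost_restrict_mdp: "exp_cost (\<lambda>i. restrict_mdp (M i) (c i)) p s = exp_cost M p s"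
  by (induction p arbitrary: s) (auto simp: restrict_mdp_def intro!: expectation_cong)

lemma init_restrict_mdp [simp]: "init (restrict_mdp m a) = init m"
  by (simp add: restrict_mdp_def)

text \<open>One quantity \<open>\<Phi>\<close> separates both sides: the random commitment
  \<open>Q\<close> achieves at most \<open>\<Phi>\<close>, while every policy costs at least
  \<open>\<Phi> / (4 / 3)\<close>.\<close>

theorem commitment_gap_le_four_thirds:
  fixes n :: nat
    and indep :: "nat set \<Rightarrow> bool"
    and B :: "nat \<Rightarrow> pbpi_box"
  assumes "matroid_on {..<n} indep"
    and "\<And>i. i < n \<Longrightarrow> valid_box (B i)"
  shows "commitment_gap B n (contains_basis {..<n} indep) \<le> 4 / 3"
proof -
  let ?F = "contains_basis {..<n} indep"
  let ?s0 = "\<lambda>_ :: nat. Closed"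
  let ?M = "\<lambda>i. box_mdp (B i)"
  let ?G = "completion_cost {..<n} ?F {}"
  let ?E = "measure_pmf.expectation"
  note m = assms(1) and valid = assms(2)
  have up: "upward_closed_on {..<n} ?F" using upward_closed_contains_basis[OF m] .
  have "\<exists>q. 0 \<le> q \<and> q \<le> 1 \<and> q * peek_cost (B i) \<le> ((4 / 3) - 1) * open_cost (B i) \<and>
      (1 - q) * open_cost (B i) + q * peek_cost (B i) \<le> (4 / 3) * peek_cost (B i)"
    if "i < n" for i
    using mixing_probability_exists[of "peek_cost (B i)" "open_cost (B i)"] valid[OF that]
    unfolding valid_box_def by metis
  then obtain q where q: "\<And>i. i < n \<Longrightarrow> 0 \<le> q i" "\<And>i. i < n \<Longrightarrow> q i \<le> 1"
      "\<And>i. i < n \<Longrightarrow> q i * peek_cost (B i) \<le> ((4 / 3) - 1) * open_cost (B i)"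
      "\<And>i. i < n \<Longrightarrow> (1 - q i) * open_cost (B i) + q i * peek_cost (B i) \<le> (4 / 3) * peek_cost (B i)"
    by metis
  have "\<exists>g. ?E (action_value (B i) a) (\<lambda>v. max (g - v) 0) = action_cost (B i) a"
    if "i < n" for i a
  proof -
    note valid_i = valid[OF that]
    have "0 \<le> action_cost (B i) a" using valid_i by (cases a) (auto simp: valid_box_def)
    with finite_action_value[OF valid_i, of a] action_value_nonneg[OF valid_i, of _ a]
    show ?thesis by (rule index_exists) auto
  qed
  then obtain g where g: "\<And>i a. i < n \<Longrightarrow>
      ?E (action_value (B i) a) (\<lambda>v. max (g i a - v) 0) = action_cost (B i) a"
    by metis
  define Dc where "Dc i a = map_pmf (max (g i a)) (action_value (B i) a)" for i a
  define Q where "Q i = random_action (q i)" for i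
  define D where "D i = bind_pmf (Q i) (Dc i)" for i
  define \<Phi> where "\<Phi> = surrogate_cost ((4 / 3)) B D n ?F {} ?s0"
  have fin_Q: "finite (set_pmf (Pi_pmf {..<n} Open Q))"
    by (intro finite_set_Pi_pmf) (simp_all add: Q_def finite_random_action)
  have fin_Dc: "finite (set_pmf (Dc i a))" if "i < n" for i a
    using finite_action_value[OF valid[OF that]] by (simp add: Dc_def)
  have fin_D: "finite (set_pmf (D i))" if "i < n" for i
    using fin_Dc[OF that] by (simp add: D_def Q_def finite_random_action)
  have nonneg_D: "0 \<le> x" if "i < n" "x \<in> set_pmf (D i)" for i x
    using that action_value_nonneg[OF valid[OF that(1)]]
    by (auto simp: D_def Dc_def le_max_iff_disj)
  have lower: "\<Phi> \<le> (4 / 3) * exp_cost ?M p ?s0" if "feasible ?M n ?F p {} ?s0" for p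
    unfolding \<Phi>_def
  proof (rule surrogate_cost_le_exp_cost[OF up _ valid fin_D nonneg_D _ _ that])
    fix i a t assume i: "i < n"
    show "?E (D i) (min t) \<le> (4 / 3) * action_cost (B i) a +
        ?E (action_value (B i) a) (\<lambda>v. min t ((4 / 3) * v))"
      unfolding D_def Q_def Dc_def
      by (rule mixture_local_approximation[OF valid[OF i] q(1-4)[OF i] _ g[OF i]]) simp
  qed auto
  have "0 \<le> \<Phi>"
  proof -
    have "?E (Pi_pmf {..<n} 0 D) (\<lambda>_. 0) \<le> ?E (Pi_pmf {..<n} 0 D) ?G"
      by (intro expectation_mono_finite finite_set_Pi_pmf fin_D completion_cost_nonneg[OF up])
         (auto simp: set_Pi_pmf PiE_dflt_def intro: nonneg_D)
    then show ?thesis by (simp add: \<Phi>_def surrogate_cost_def weight_pmf_def[abs_def])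
  qed
  have policy: "\<exists>p. feasible (\<lambda>i. restrict_mdp (?M i) (c i)) n ?F p {} ?s0 \<and>
      exp_cost ?M p ?s0 \<le> ?E (Pi_pmf {..<n} 0 (\<lambda>i. Dc i (c i))) ?G" for c
  proof -
    have "indep {}" using m by (simp add: matroid_on_def)
    moreover have "0 \<le> tval (box_mdp b) Closed" for b by (simp add: box_mdp_def)
    ultimately show ?thesis
      using committed_policy_exists[where c = c and g = "\<lambda>i. g i (c i)" and S = "{}" and s = ?s0,
          OF m valid g]
      by (simp add: exp_cost_restrict_mdp surrogate_cost_def weight_pmf_def[abs_def] Dc_def)
  qed
  let ?opt = "\<lambda>c. opt_cost (\<lambda>i. restrict_mdp (?M i) (c i)) n ?F"
  have lower_div: "\<Phi> / (4 / 3) \<le> exp_cost ?M p ?s0" if "feasible ?M n ?F p {} ?s0" for p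
    using lower[OF that] by simp
  have lower_c: "\<Phi> / (4 / 3) \<le> exp_cost ?M p ?s0"
    if "feasible (\<lambda>i. restrict_mdp (?M i) (c i)) n ?F p {} ?s0" for c p
    using lower_div[OF feasible_restrict_mdp[OF that]] .
  \<comment> \<open>\<open>policy\<close> also serves to show that the infimum is over a nonempty
    set.\<close>
  have opt_ge: "\<Phi> / (4 / 3) \<le> ?opt c" for c
    unfolding opt_cost_def exp_cost_restrict_mdp init_restrict_mdp init_box_mdp
    using policy[of c] lower_c[of c] by (intro cINF_greatest) blast+
  have opt_le: "?opt c \<le> ?E (Pi_pmf {..<n} 0 (\<lambda>i. Dc i (c i))) ?G" for c
  proof -
    obtain p where p: "feasible (\<lambda>i. restrict_mdp (?M i) (c i)) n ?F p {} ?s0"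
        "exp_cost ?M p ?s0 \<le> ?E (Pi_pmf {..<n} 0 (\<lambda>i. Dc i (c i))) ?G"
      using policy[of c] by blast
    have "?opt c \<le> exp_cost ?M p ?s0"
      unfolding opt_cost_def exp_cost_restrict_mdp init_restrict_mdp init_box_mdp
      using p(1) lower_c by (intro cINF_lower bdd_belowI2[where m = "\<Phi> / (4 / 3)"]) auto
    then show ?thesis using p(2) by simp
  qed
  have committed: "pbpi_committed_opt B n ?F Q \<le> \<Phi>"
  proof -
    have "pbpi_committed_opt B n ?F Q \<le>
        ?E (Pi_pmf {..<n} Open Q) (\<lambda>c. ?E (Pi_pmf {..<n} 0 (\<lambda>i. Dc i (c i))) ?G)"
      unfolding pbpi_committed_opt_def by (intro expectation_mono_finite fin_Q opt_le)
    \<comment> \<open>Drawing independent commitments and then independent weights gives the product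
      of the mixtures \<open>D i\<close>, the law used in the lower bound.\<close>
    also have "\<dots> = ?E (Pi_pmf {..<n} 0 D) ?G"
      unfolding D_def
      by (subst Pi_pmf_bind[where d' = Open])
         (auto intro!: expectation_bind_finite[symmetric] fin_Q finite_set_Pi_pmf fin_Dc)
    finally show ?thesis
      by (simp add: \<Phi>_def surrogate_cost_def weight_pmf_def[abs_def])
  qed
  \<comment> \<open>Any commitment would do here; a feasible policy is needed to make the infimum
    defining \<open>pbpi_opt\<close> one over a nonempty set.\<close>
  obtain p where "feasible (\<lambda>i. restrict_mdp (?M i) Open) n ?F p {} ?s0"
    using policy[of "\<lambda>_. Open"] by blast
  then have p: "feasible ?M n ?F p {} ?s0" by (rule feasible_restrict_mdp)
  then have opt: "\<Phi> / (4 / 3) \<le> pbpi_opt B n ?F"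
    unfolding pbpi_opt_def opt_cost_def init_box_mdp
    using p lower_div by (intro cINF_greatest) blast+
  \<comment> \<open>Bounds the committed optima from below, so that their infimum is at most the
    value at \<open>Q\<close>.\<close>
  have "\<Phi> / (4 / 3) \<le> pbpi_committed_opt B n ?F q" for q
  proof -
    have "finite (set_pmf (Pi_pmf {..<n} Open q))"
      by (intro finite_set_Pi_pmf) (auto intro: finite_box_actions)
    then have "?E (Pi_pmf {..<n} Open q) (\<lambda>_. \<Phi> / (4 / 3)) \<le> pbpi_committed_opt B n ?F q"
      unfolding pbpi_committed_opt_def by (rule expectation_mono_finite) (rule opt_ge)
    then show ?thesis by simp
  qed
  then have "(INF q. pbpi_committed_opt B n ?F q) \<le> pbpi_committed_opt B n ?F Q"
    by (intro cINF_lower bdd_belowI2[where m = "\<Phi> / (4 / 3)"]) auto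
  also have "\<dots> \<le> 4 / 3 * pbpi_opt B n ?F"
    using committed opt by simp
  \<comment> \<open>\<open>0 \<le> \<Phi>\<close> makes the denominator nonnegative; where it is
    zero, the quotient is 0 by convention.\<close>
  finally show ?thesis
    using opt \<open>0 \<le> \<Phi>\<close>
    by (cases "pbpi_opt B n ?F = 0") (auto simp: commitment_gap_def divide_le_eq)
qed

theorem theorem4:
  fixes n :: nat
    and indep :: "nat set \<Rightarrow> bool"
    and B :: "nat \<Rightarrow> pbpi_box"
  assumes "matroid_on {..<n} indep"
    and "\<And>i. i < n \<Longrightarrow> valid_box (B i)"
  shows "commitment_gap B n (contains_basis {..<n} indep) \<le> sqrt 2"
proof -
  have "4 / 3 \<le> sqrt (2 :: real)" by (rule real_le_rsqrt) (simp add: power2_eq_square)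
  with commitment_gap_le_four_thirds[OF assms(1)] assms(2) show ?thesis by fastforce
qed

end
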